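(* Let $p$ be a prime, let $k\ge 2$, and let $\chi$ be the characteristic vector of a linear $[n,k]_p$ code (with respect to some generator matrix and the matrix $G_k$ defined in the context). With $\widehat{M}_k^{[\chi]}(l)$ $(1\le l\le k)$, $\widehat{M}_k^{[\chi]}=\widehat{M}_k^{[\chi]}(k)$, $\widehat{\chi}=\widehat{M}_k^{[\chi]}(1)$ and the matrices $T_{k,l}$ $(2\le l\le k)$ as defined in the context, $$\left(\widehat{M}_k^{[\chi]}(l)\right)^{\mathrm T}=T_{k,l}\cdot\left(\widehat{M}_k^{[\chi]}(l-1)\right)^{\mathrm T},\qquad l=2,\dots,k,$$ and $$\left(\widehat{M}_k^{[\chi]}\right)^{\mathrm T}=T_{k,k}\cdot T_{k,k-1}\cdots T_{k,2}\cdot\widehat{\chi}^{\,\mathrm T}.$$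
   Context: **Matrices $G_k$, $M_k$.** $\mathbb{F}_p=\{0,1,\dots,p-1\}$, $\theta_k=\theta(p,k)=\frac{p^k-1}{p-1}$. The $k\times\theta_k$ matrices $G_k$ over $\mathbb{F}_p$ are defined by $G_1=(1)$ and, for $k\ge2$, $$G_{k}=\left(\begin{array}{ccccc}\mathbf{0}&\mathbf{1}&\ldots&\mathbf{p-1}&1\\ G_{k-1}&G_{k-1}&\ldots&G_{k-1}&\mathbf{0}^{\mathrm T}\end{array}\right),$$ where $\mathbf{u}=(u,\dots,u)$ has length $\theta_{k-1}$. Its columns form a maximal set of pairwise nonproportional nonzero vectors of $\mathbb{F}_p^k$. Put $M_k=G_k^{\mathrm T}G_k=(m_{ij})$ over $\mathbb{F}_p$; in particular $M_1=(1)$. **Characteristic vector.** A linear $[n,k]_p$ code $C$ is a $k$-dimensional subspace of $\mathbb{F}_p^n$; a generator matrix $G$ is a $k\times n$ matrix whose rows form a basis of $C$, assumed to have no zero columns. The characteristic vector of $C$ with respect to $G$ is $\chi=(\chi_1,\ldots,\chi_{\theta_k})\in\mathbb{Z}^{\theta_k}$, where $\chi_u$ is the number of columns of $G$ equal or proportional to the $u$-th column of $G_k$. **Matrices $M_k^{[\chi]}$ and $M_k^{[\chi]}(l)$.** For $k\ge1$ and any $\chi\in\mathbb{Z}^{\theta_k}$, $M_k^{[\chi]}$ is the $\theta_k\times p$ integer matrix whose $i$-th row is $(\omega_0^{(i)},\ldots,\omega_{p-1}^{(i)})$ with $\omega_u^{(i)}=\sum\{\chi_j : 1\le j\le\theta_k,\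 m_{ij}=u\}$. In particular, for $a\in\mathbb{Z}$, $M_1^{[a]}=(0,a,0,\dots,0)$. Since $\theta_k=p\,\theta_{k-1}+1$ for $k\ge 2$, split $\chi=(\chi^{(0)}|\chi^{(1)}|\ldots|\chi^{(p-1)}|\chi^{(p)})$ with $\chi^{(j)}\in\mathbb{Z}^{\theta_{k-1}}$ for $0\le j\le p-1$ and $\chi^{(p)}\in\mathbb{Z}$. The $\theta_k\times p$ matrices $M_k^{[\chi]}(l)$, $1\le l\le k$, are defined recursively by $M_k^{[\chi]}(k)=M_k^{[\chi]}$ and, for $1\le l<k$, $$M_k^{[\chi]}(l)=\left(\begin{array}{l}M_{k-1}^{[\chi^{(0)}]}(l)\\ M_{k-1}^{[\chi^{(1)}]}(l)\\ \ \ \vdots \\ M_{k-1}^{[\chi^{(p-1)}]}(l)\\ M_1^{[\chi^{(p)}]}\end{array}\right).$$ $\widehat{M}_k^{[\chi]}(l)$ is the row vector of length $p\,\theta_k$ obtained by concatenating all rows of $M_k^{[\chi]}(l)$ in order. **Matrices $P$, $E_j$, $T_{k,l}$.** $P=\left(\begin{array}{cc}\mathbf{0}&1\\ I_{p-1}&\mathbf{0}^{\mathrm T}\end{array}\right)$ is the $p\times p$ permutation matrix realizing the right circular shift on column vectors. For $j=0,\dots,p-1$, $E_j$ is the $p\times p$ matrix whose $(j+1)$-th row is the all-ones vector and whose other rows are zero. For integers $2\le l\le k$, the square integer matrices $T_{k,l}$ of order $p\,\theta_k$ are defined by: 1) for $k=l=2$, $$T_{2,2}=\left(\begin{array}{llllll}I_p&I_p&I_p&\ldots&I_p&P^{-1}\\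 I_p&P&P^2&\ldots&P^{p-1}&I_p\\ I_p&P^{2}&P^{4}&\ldots&P^{2(p-1)}&P\\ \vdots\\ I_p&P^{p-1}&P^{2(p-1)}&\ldots&P^{(p-1)^2}&P^{p-2}\\ E_0&E_1&E_2&\ldots&E_{p-1}&E_1\end{array}\right)$$ (for $0\le t,s\le p-1$ the block in block-row $t$, block-column $s$ is $P^{ts}$, and the last block in block-row $t$ is $P^{t-1}$); 2) for $k>l$, $$T_{k,l}=\left(\begin{array}{cc}I_p\otimes T_{k-1,l}&\mathbf{0}\\ \mathbf{0}&I_p\end{array}\right);$$ 3) for $k=l>2$, with $\theta=\theta(p,k-1)$, $$T_{k,k}=\left(\begin{array}{lllll}I_{\theta}\otimes I_p&I_{\theta}\otimes I_p&\ldots&I_{\theta}\otimes I_p&\mathbf{1}\otimes P^{-1}\\ I_{\theta}\otimes I_p&I_{\theta}\otimes P&\ldots&I_{\theta}\otimes P^{p-1}&\mathbf{1}\otimes I_p\\ I_{\theta}\otimes I_p&I_{\theta}\otimes P^{2}&\ldots&I_{\theta}\otimes P^{2(p-1)}&\mathbf{1}\otimes P\\ \vdots\\ I_{\theta}\otimes I_p&I_{\theta}\otimes P^{p-1}&\ldots&I_{\theta}\otimes P^{(p-1)^2}&\mathbf{1}\otimes P^{p-2}\\ E_0\;\;\mathbf{0}&E_1\;\;\mathbf{0}&\ldots&E_{p-1}\;\;\mathbf{0}&I_p\end{array}\right),$$ where $\mathbf{1}$ is the all-ones column vector of length $\theta$, and in the last block-row $E_j\;\;\mathbf{0}$ denotes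 the $p\times p\theta$ matrix whose first $p$ columns form $E_j$ and whose other columns are zero. Here $\otimes$ is the Kronecker product. *)

theory Defs
  imports
    Berlekamp_Zassenhaus.Finite_Field
    Jordan_Normal_Form.VS_Connect
begin

text \<open>
  The prime \<open>p\<close> is the cardinality of a type of class \<^class>\<open>prime_card\<close>, and the prime field is
  \<^typ>\<open>'p mod_ring\<close>; the residue \<open>u\<close> is \<^term>\<open>of_nat u\<close>.  Constants that mention the field only
  internally take the type argument \<^term>\<open>TYPE('p::prime_card)\<close>.  Rows, columns and blocks are
  numbered from 0.
\<close>

definition theta :: "nat \<Rightarrow> nat \<Rightarrow> nat" where
  "theta p k = (p ^ k - 1) div (p - 1)"


subsection \<open>Block matrices\<close>

text \<open>\<open>block_mat m n a b B\<close> is the \<open>m \<times> n\<close> array of blocks \<open>B i j\<close>, each of size \<open>a \<times> b\<close>.\<close>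

definition block_mat :: "nat \<Rightarrow> nat \<Rightarrow> nat \<Rightarrow> nat \<Rightarrow> (nat \<Rightarrow> nat \<Rightarrow> 'a mat) \<Rightarrow> 'a mat" where
  "block_mat m n a b B =
     mat (m * a) (n * b) (\<lambda>(i, j). B (i div a) (j div b) $$ (i mod a, j mod b))"

definition kronecker :: "'a::semiring_1 mat \<Rightarrow> 'a mat \<Rightarrow> 'a mat" (infixl \<open>\<otimes>\<^sub>k\<close> 72) where
  "A \<otimes>\<^sub>k B = block_mat (dim_row A) (dim_col A) (dim_row B) (dim_col B) (\<lambda>i j. A $$ (i, j) \<cdot>\<^sub>m B)"

definition mat_inv :: "'a::semiring_1 mat \<Rightarrow> 'a mat" where
  "mat_inv A = (THE B. B \<in> carrier_mat (dim_col A) (dim_row A) \<and> inverts_mat A B \<and> inverts_mat B A)"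


subsection \<open>The matrices \<open>G\<^sub>k\<close> and \<open>M\<^sub>k\<close>\<close>

fun G_mat :: "nat \<Rightarrow> 'p::prime_card mod_ring mat" where
  "G_mat k =
     (if k \<le> 1 then 1\<^sub>m 1
      else let p = CARD('p); \<theta> = theta p (k - 1) in
        four_block_mat
          (block_mat 1 p 1 \<theta> (\<lambda>_ u. mat 1 \<theta> (\<lambda>_. of_nat u)))  (1\<^sub>m 1)
          (block_mat 1 p (k - 1) \<theta> (\<lambda>_ _. G_mat (k - 1)))      (0\<^sub>m (k - 1) 1))"

declare G_mat.simps [simp del]

definition M_mat :: "nat \<Rightarrow> 'p::prime_card mod_ring mat" where
  "M_mat k = transpose_mat (G_mat k) * G_mat k"


subsection \<open>Linear codes and characteristic vectors\<close>

definition linear_code :: "nat \<Rightarrow> nat \<Rightarrow> 'p::prime_card mod_ring vec set \<Rightarrow> bool" where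
  "linear_code n k C \<longleftrightarrow>
     VectorSpace.subspace class_ring C (module_vec TYPE('p mod_ring) n) \<and>
     vectorspace.dim class_ring ((module_vec TYPE('p mod_ring) n)\<lparr>carrier := C\<rparr>) = k"

definition generator_matrix ::
  "nat \<Rightarrow> nat \<Rightarrow> 'p::prime_card mod_ring vec set \<Rightarrow> 'p mod_ring mat \<Rightarrow> bool" where
  "generator_matrix n k C A \<longleftrightarrow>
     A \<in> carrier_mat k n \<and>
     distinct (rows A) \<and>
     vectorspace.basis class_ring ((module_vec TYPE('p mod_ring) n)\<lparr>carrier := C\<rparr>) (set (rows A)) \<and>
     (\<forall>j<n. col A j \<noteq> 0\<^sub>v k)"

definition characteristic_vector :: "nat \<Rightarrow> 'p::prime_card mod_ring mat \<Rightarrow> int vec" where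
  "characteristic_vector k A =
     vec (theta CARD('p) k)
       (\<lambda>u. int (card {j. j < dim_col A \<and> (\<exists>c. c \<noteq> 0 \<and> col A j = c \<cdot>\<^sub>v col (G_mat k) u)}))"


subsection \<open>The matrices \<open>M\<^sub>k\<^sup>\<chi>\<close> and \<open>M\<^sub>k\<^sup>\<chi>(l)\<close>\<close>

definition M_chi :: "'p::prime_card itself \<Rightarrow> nat \<Rightarrow> int vec \<Rightarrow> int mat" where
  "M_chi P k \<chi> =
     mat (theta CARD('p) k) CARD('p)
       (\<lambda>(i, u). \<Sum>j | j < theta CARD('p) k \<and> M_mat k $$ (i, j) = (of_nat u :: 'p mod_ring). \<chi> $ j)"

text \<open>\<open>M_chi_level P k \<chi> l\<close> is meaningful for \<open>1 \<le> l \<le> k\<close> only.\<close>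

fun M_chi_level :: "'p::prime_card itself \<Rightarrow> nat \<Rightarrow> int vec \<Rightarrow> nat \<Rightarrow> int mat" where
  "M_chi_level P k \<chi> l =
     (if l < k then
        let p = CARD('p); \<theta> = theta p (k - 1) in
          block_mat p 1 \<theta> p (\<lambda>j _. M_chi_level P (k - 1) (vec \<theta> (\<lambda>i. \<chi> $ (j * \<theta> + i))) l)
          @\<^sub>r M_chi P 1 (vec 1 (\<lambda>_. \<chi> $ (p * \<theta>)))
      else M_chi P k \<chi>)"

declare M_chi_level.simps [simp del]

definition concat_rows :: "'a mat \<Rightarrow> 'a mat" where
  "concat_rows A =
     mat 1 (dim_row A * dim_col A) (\<lambda>(_, i). A $$ (i div dim_col A, i mod dim_col A))"

definition M_hat :: "'p::prime_card itself \<Rightarrow> nat \<Rightarrow> int vec \<Rightarrow> nat \<Rightarrow> int mat" where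
  "M_hat P k \<chi> l = concat_rows (M_chi_level P k \<chi> l)"

definition chi_hat :: "'p::prime_card itself \<Rightarrow> nat \<Rightarrow> int vec \<Rightarrow> int mat" where
  "chi_hat P k \<chi> = M_hat P k \<chi> 1"


subsection \<open>The matrices \<open>P\<close>, \<open>E\<^sub>j\<close> and \<open>T\<^sub>k\<^sub>,\<^sub>l\<close>\<close>

definition shift_mat :: "nat \<Rightarrow> int mat" where
  "shift_mat p = four_block_mat (0\<^sub>m 1 (p - 1)) (1\<^sub>m 1) (1\<^sub>m (p - 1)) (0\<^sub>m (p - 1) 1)"

text \<open>The matrix \<open>P\<^sup>t\<^sup>-\<^sup>1\<close>, where \<open>t\<close> may be 0.\<close>

definition shift_pred_pow :: "nat \<Rightarrow> nat \<Rightarrow> int mat" where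
  "shift_pred_pow p t = (if t = 0 then mat_inv (shift_mat p) else shift_mat p ^\<^sub>m (t - 1))"

definition E_mat :: "nat \<Rightarrow> nat \<Rightarrow> int mat" where
  "E_mat p j = mat p p (\<lambda>(r, _). if r = j then 1 else 0)"

definition T22_mat :: "nat \<Rightarrow> int mat" where
  "T22_mat p =
     four_block_mat
       (block_mat p p p p (\<lambda>t s. shift_mat p ^\<^sub>m (t * s)))  (block_mat p 1 p p (\<lambda>t _. shift_pred_pow p t))
       (block_mat 1 p p p (\<lambda>_ s. E_mat p s))              (E_mat p 1)"

definition Tkk_mat :: "nat \<Rightarrow> nat \<Rightarrow> int mat" where
  "Tkk_mat p k =
     (let \<theta> = theta p (k - 1) in
      four_block_mat
        (block_mat p p (p * \<theta>) (p * \<theta>) (\<lambda>t s. 1\<^sub>m \<theta> \<otimes>\<^sub>k shift_mat p ^\<^sub>m (t * s)))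
        (block_mat p 1 (p * \<theta>) p (\<lambda>t _. mat \<theta> 1 (\<lambda>_. 1) \<otimes>\<^sub>k shift_pred_pow p t))
        (block_mat 1 p p (p * \<theta>)
           (\<lambda>_ s. mat p (p * \<theta>) (\<lambda>(i, j). if j < p then E_mat p s $$ (i, j) else 0)))
        (1\<^sub>m p))"

text \<open>\<open>T_mat p k l\<close> is meaningful for \<open>2 \<le> l \<le> k\<close> only.\<close>

fun T_mat :: "nat \<Rightarrow> nat \<Rightarrow> nat \<Rightarrow> int mat" where
  "T_mat p k l =
     (if l < k then
        let N = p * (p * theta p (k - 1)) in
          four_block_mat (1\<^sub>m p \<otimes>\<^sub>k T_mat p (k - 1) l) (0\<^sub>m N p) (0\<^sub>m p N) (1\<^sub>m p)
      else if k = 2 then T22_mat p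
      else Tkk_mat p k)"

declare T_mat.simps [simp del]

end

theory Submission
  imports Defs
begin

text \<open>
  The identity holds for every integer vector \<open>\<chi>\<close> and is checked entrywise.  From the recursion for
  \<open>G\<^sub>k\<close>, the matrix \<open>M\<^sub>k\<close> consists of the blocks \<open>t s + M\<^sub>k\<^sub>-\<^sub>1\<close> for \<open>t, s < p\<close>, bordered by a last
  column with constant blocks \<open>t\<close>, a last row with constant blocks \<open>s\<close>, and a corner 1.  Adding \<open>t s\<close>
  to the residues shifts a row of counts cyclically, which is multiplication by the power \<open>t s\<close> of \<open>P\<close>;
  a single count in position 1 is moved to position \<open>t\<close> by the power \<open>t - 1\<close>; and \<open>E\<^sub>s\<close> collects the
  total of a row in position \<open>s\<close>.  This is the case \<open>k = l\<close>; for \<open>k > l\<close> both sides split into the same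
  blocks, and induction on \<open>k\<close> applies.
\<close>

subsection \<open>Indexing of block matrices\<close>

lemma block_index_less:
  fixes i m r a :: nat
  assumes "i < m" "r < a"
  shows "i * a + r < m * a"
proof -
  have "i * a + r < Suc i * a" using assms(2) by simp
  also have "\<dots> \<le> m * a" using assms(1) by (intro mult_le_mono1) simp
  finally show ?thesis .
qed

lemma block_index_cases:
  fixes r m a :: nat
  assumes "r < m * a"
  obtains i r' where "i < m" "r' < a" "r = i * a + r'"
proof
  have "0 < a" using assms by (cases a) auto
  show "r div a < m" using assms by (simp add: less_mult_imp_div_less)
  show "r mod a < a" using \<open>0 < a\<close> by simp
qed simp

lemma sum_block_index:
  fixes f :: "nat \<Rightarrow> 'a::comm_monoid_add"
  shows "(\<Sum>c<m * a. f c) = (\<Sum>i<m. \<Sum>r<a. f (i * a + r))"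
proof -
  have "(\<Sum>r<a. f (i * a + r)) = sum f {i * a..<i * a + a}" for i
    using sum.shift_bounds_nat_ivl[of f 0 "i * a" a] by (simp add: atLeast0LessThan add.commute)
  then show ?thesis by (simp add: sum.nat_group[of f a m, symmetric])
qed

lemma sum_lessThan_add:
  fixes f :: "nat \<Rightarrow> 'a::comm_monoid_add"
  shows "(\<Sum>c<m + a. f c) = (\<Sum>c<m. f c) + (\<Sum>r<a. f (m + r))"
  by (induction a) (simp_all add: add.assoc)

lemma index_block_mat:
  assumes "i < m" "j < n" "r < a" "c < b"
  shows "block_mat m n a b B $$ (i * a + r, j * b + c) = B i j $$ (r, c)"
  using assms by (simp add: block_mat_def block_index_less)

lemma dim_block_mat [simp]:
  "dim_row (block_mat m n a b B) = m * a" "dim_col (block_mat m n a b B) = n * b"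
  by (simp_all add: block_mat_def)

lemma dim_kronecker [simp]:
  "dim_row (A \<otimes>\<^sub>k B) = dim_row A * dim_row B" "dim_col (A \<otimes>\<^sub>k B) = dim_col A * dim_col B"
  by (simp_all add: kronecker_def)

lemma index_kronecker:
  assumes "A \<in> carrier_mat m n" "B \<in> carrier_mat a b" "i < m" "j < n" "r < a" "c < b"
  shows "(A \<otimes>\<^sub>k B) $$ (i * a + r, j * b + c) = A $$ (i, j) * B $$ (r, c)"
  using assms by (auto simp: kronecker_def index_block_mat)

lemma index_mult_mat_sum:
  assumes "A \<in> carrier_mat nr n" "B \<in> carrier_mat n nc" "i < nr" "j < nc"
  shows "(A * B) $$ (i, j) = (\<Sum>c<n. A $$ (i, c) * B $$ (c, j))"
  using assms by (auto simp: scalar_prod_def atLeast0LessThan intro!: sum.cong)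

section \<open>The numbers \<open>theta p k\<close> and residues modulo p\<close>

lemma prime_card_ge_2: "2 \<le> CARD('p::prime_card)"
  using prime_card[where 'a='p] by (rule prime_ge_2_nat)

lemma theta_1: "2 \<le> p \<Longrightarrow> theta p (Suc 0) = 1"
  by (simp add: theta_def)

lemma theta_Suc:
  assumes "2 \<le> p"
  shows "theta p (Suc k) = p * theta p k + 1"
proof -
  obtain q where q: "p = Suc q" "0 < q" using assms by (cases p) auto
  \<comment> \<open>\<open>theta\<close> is a truncated quotient, so p^m - 1 is first shown to be a
    multiple of q = p - 1. The cofactor grows from d to p d + 1, which is the claimed
    recursion.\<close>
  have "\<exists>d. p ^ m = q * d + 1" for m
  proof (induction m)
    case (Suc m)
    then obtain d where "p ^ m = q * d + 1" by blast
    then have "p ^ Suc m = q * (p * d + 1) + 1"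
      using q(1) by (simp add: algebra_simps)
    then show ?case by blast
  qed (auto intro: exI[of _ 0])
  then obtain d where d: "p ^ k = q * d + 1" by blast
  then have "p ^ Suc k = q * (p * d + 1) + 1"
    using q(1) by (simp add: algebra_simps)
  with d show ?thesis using q by (simp add: theta_def)
qed

lemma of_nat_mod_ring_eq_iff:
  "(of_nat a :: 'p::prime_card mod_ring) = of_nat b \<longleftrightarrow> a mod CARD('p) = b mod CARD('p)"
  by (simp add: of_nat_eq_iff_cong_CHAR cong_def)

subsection \<open>The matrices \<open>G\<^sub>k\<close> and \<open>M\<^sub>k\<close>\<close>

lemma G_mat_carrier:
  assumes "1 \<le> k"
  shows "(G_mat k :: 'p::prime_card mod_ring mat) \<in> carrier_mat k (theta CARD('p) k)"
proof (cases "k = 1")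
  case True
  then show ?thesis using theta_1[OF prime_card_ge_2[where 'p='p]] by (simp add: G_mat.simps)
next
  case False
  then obtain k' where "k = Suc k'" "1 \<le> k'" using assms by (cases k) auto
  then show ?thesis
    by (intro carrier_matI) (simp_all add: G_mat.simps[of "Suc k'"] Let_def theta_Suc[OF prime_card_ge_2])
qed

lemma G_mat_Suc_index:
  fixes k :: nat
  defines "\<theta> \<equiv> theta CARD('p::prime_card) k" and "G \<equiv> G_mat (Suc k) :: 'p mod_ring mat"
  assumes "1 \<le> k"
  shows "s < CARD('p) \<Longrightarrow> v < \<theta> \<Longrightarrow> G $$ (0, s * \<theta> + v) = of_nat s"
    and "s < CARD('p) \<Longrightarrow> v < \<theta> \<Longrightarrow> r < k \<Longrightarrow> G $$ (Suc r, s * \<theta> + v) = G_mat k $$ (r, v)"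
    and "G $$ (0, CARD('p) * \<theta>) = 1"
    and "r < k \<Longrightarrow> G $$ (Suc r, CARD('p) * \<theta>) = 0"
proof -
  let ?U = "block_mat 1 CARD('p) 1 \<theta> (\<lambda>_ u. mat 1 \<theta> (\<lambda>_. of_nat u)) :: 'p mod_ring mat"
  let ?L = "block_mat 1 CARD('p) k \<theta> (\<lambda>_ _. G_mat k) :: 'p mod_ring mat"
  have G: "G = four_block_mat ?U (1\<^sub>m 1) ?L (0\<^sub>m k 1)"
    using assms(3) by (simp add: G_def \<theta>_def G_mat.simps[of "Suc k"] Let_def)
  {
    assume "s < CARD('p)" "v < \<theta>"
    then have lt: "s * \<theta> + v < CARD('p) * \<theta>" by (rule block_index_less)
    \<comment> \<open>The row index is spelled \<open>0 * 1 + 0\<close> to have the shape block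
      number times block size plus offset that \<open>index_block_mat\<close> expects; the same
      device recurs below.\<close>
    have "?U $$ (0 * 1 + 0, s * \<theta> + v) = mat 1 \<theta> (\<lambda>_. of_nat s) $$ (0, v)"
      using \<open>s < CARD('p)\<close> \<open>v < \<theta>\<close> by (intro index_block_mat) auto
    with lt \<open>v < \<theta>\<close> show "G $$ (0, s * \<theta> + v) = of_nat s" by (simp add: G)
    assume "r < k"
    have "?L $$ (0 * k + r, s * \<theta> + v) = G_mat k $$ (r, v)"
      using \<open>s < CARD('p)\<close> \<open>v < \<theta>\<close> \<open>r < k\<close> by (intro index_block_mat) auto
    with lt \<open>r < k\<close> show "G $$ (Suc r, s * \<theta> + v) = G_mat k $$ (r, v)" by (simp add: G)
  }
  show "G $$ (0, CARD('p) * \<theta>) = 1" by (simp add: G)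
  show "r < k \<Longrightarrow> G $$ (Suc r, CARD('p) * \<theta>) = 0" by (simp add: G)
qed

lemma M_mat_index:
  assumes "1 \<le> k" "i < theta CARD('p) k" "j < theta CARD('p) k"
  shows "(M_mat k :: 'p::prime_card mod_ring mat) $$ (i, j)
    = (\<Sum>r<k. G_mat k $$ (r, i) * G_mat k $$ (r, j))"
  using assms G_mat_carrier[OF assms(1), where 'p='p]
  by (auto simp: M_mat_def scalar_prod_def atLeast0LessThan intro!: sum.cong)

lemma M_mat_1: "(M_mat (Suc 0) :: 'p::prime_card mod_ring mat) $$ (0, 0) = 1"
  by (simp add: M_mat_index theta_1 prime_card_ge_2 G_mat.simps)

text \<open>Column \<open>s * \<theta> + v\<close> of \<open>G_mat (Suc k)\<close> is s on top of
  column v of \<open>G_mat k\<close>, so the inner product of two such columns splits into t s and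
  an entry of \<open>M_mat k\<close>. The last column is the first unit vector, so products with it
  read off the top entry.\<close>

lemma M_mat_Suc_index:
  fixes k :: nat
  defines "p \<equiv> CARD('p::prime_card)"
  defines "\<theta> \<equiv> theta p k" and "M \<equiv> M_mat (Suc k) :: 'p mod_ring mat"
  assumes k: "1 \<le> k"
  shows "t < p \<Longrightarrow> i < \<theta> \<Longrightarrow> s < p \<Longrightarrow> v < \<theta> \<Longrightarrow>
      M $$ (t * \<theta> + i, s * \<theta> + v) = of_nat (t * s) + M_mat k $$ (i, v)"
    and "t < p \<Longrightarrow> i < \<theta> \<Longrightarrow> M $$ (t * \<theta> + i, p * \<theta>) = of_nat t"
    and "s < p \<Longrightarrow> v < \<theta> \<Longrightarrow> M $$ (p * \<theta>, s * \<theta> + v) = of_nat s"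
    and "M $$ (p * \<theta>, p * \<theta>) = 1"
proof -
  have lt: "s * \<theta> + v < theta p (Suc k)" if "s < p" "v < \<theta>" for s v
    using block_index_less[OF that] theta_Suc[OF prime_card_ge_2[where 'p='p]]
    by (simp add: p_def \<theta>_def)
  have last: "p * \<theta> < theta p (Suc k)"
    using theta_Suc[OF prime_card_ge_2[where 'p='p]] by (simp add: p_def \<theta>_def)
  note G = G_mat_Suc_index[OF k, where 'p='p, folded p_def, folded \<theta>_def]
  note M = M_mat_index[of "Suc k", where 'p='p, folded p_def, folded M_def]
  \<comment> \<open>\<open>sum.lessThan_Suc_shift\<close> splits off row 0, the row that G gains on
    top; the default rule, which splits off the bottom row, is disabled.\<close>
  show "t < p \<Longrightarrow> i < \<theta> \<Longrightarrow> s < p \<Longrightarrow> v < \<theta> \<Longrightarrow>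
      M $$ (t * \<theta> + i, s * \<theta> + v) = of_nat (t * s) + M_mat k $$ (i, v)"
    using k M_mat_index[OF k, where 'p='p, folded p_def, folded \<theta>_def]
    by (simp add: M lt sum.lessThan_Suc_shift G del: sum.lessThan_Suc)
  show "t < p \<Longrightarrow> i < \<theta> \<Longrightarrow> M $$ (t * \<theta> + i, p * \<theta>) = of_nat t"
    by (simp add: M lt last sum.lessThan_Suc_shift G del: sum.lessThan_Suc)
  show "s < p \<Longrightarrow> v < \<theta> \<Longrightarrow> M $$ (p * \<theta>, s * \<theta> + v) = of_nat s"
    by (simp add: M lt last sum.lessThan_Suc_shift G del: sum.lessThan_Suc)
  show "M $$ (p * \<theta>, p * \<theta>) = 1"
    by (simp add: M lt last sum.lessThan_Suc_shift G del: sum.lessThan_Suc)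
qed

subsection \<open>Powers of the shift matrix\<close>

lemma shift_mat_carrier [simp]: "0 < p \<Longrightarrow> shift_mat p \<in> carrier_mat p p"
  by (rule carrier_matI) (simp_all add: shift_mat_def)

lemma shift_mat_dim [simp]:
  assumes "0 < p"
  shows "dim_row (shift_mat p) = p" "dim_col (shift_mat p) = p"
  using shift_mat_carrier[OF assms] by auto

lemma shift_mat_index:
  assumes "w < p" "u < p"
  shows "shift_mat p $$ (w, u) = (if w = (u + 1) mod p then 1 else 0)"
proof (cases "u = p - 1")
  case True
  with assms show ?thesis by (auto simp: shift_mat_def)
next
  case False
  with assms have "(u + 1) mod p = u + 1" by simp
  with assms False show ?thesis by (auto simp: shift_mat_def)
qed

lemma shift_mat_pow_carrier [simp]: "0 < p \<Longrightarrow> shift_mat p ^\<^sub>m m \<in> carrier_mat p p"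
  by (intro pow_carrier_mat shift_mat_carrier)

text \<open>P sends unit vector u to unit vector u + 1 modulo p, hence its power m sends it to u +
  m. This holds for every exponent, so t s can be used unreduced.\<close>

lemma shift_mat_pow_index:
  assumes "w < p" "u < p"
  shows "(shift_mat p ^\<^sub>m m) $$ (w, u) = (if w = (u + m) mod p then 1 else 0)"
  using assms
proof (induction m arbitrary: w u)
  case 0
  then show ?case by simp
next
  case (Suc m)
  have "(shift_mat p ^\<^sub>m Suc m) $$ (w, u)
      = (\<Sum>v<p. (shift_mat p ^\<^sub>m m) $$ (w, v) * shift_mat p $$ (v, u))"
    unfolding pow_mat.simps using Suc.prems by (intro index_mult_mat_sum) auto
  also have "\<dots> = (\<Sum>v<p. if v = (u + 1) mod p then (if w = (v + m) mod p then 1 else 0) else 0)"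
    using Suc by (intro sum.cong) (auto simp: shift_mat_index)
  also have "\<dots> = (if w = (u + Suc m) mod p then 1 else 0)"
    using Suc.prems by (simp add: mod_simps)
  finally show ?case .
qed

text \<open>\<open>^\<^sub>m\<close> unfolds with the new factor on the right. Having it on the left
  as well shows that the left inverse of P found below is also a right inverse.\<close>

lemma pow_mat_commute:
  assumes "A \<in> carrier_mat n n"
  shows "A * A ^\<^sub>m m = A ^\<^sub>m m * A"
  using assms
proof (induction m)
  case (Suc m)
  then show ?case
    using assoc_mult_mat[OF assms pow_carrier_mat[OF assms, of m] assms] by simp
qed simp

text \<open>P^p = 1 makes Q = P^(p-1) a two-sided inverse. As \<open>mat_inv\<close> is a definite
  description, uniqueness has to be shown too: B = (Q P) B = Q (P B) = Q.\<close>

lemma shift_mat_inv: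
  assumes "0 < p"
  shows "mat_inv (shift_mat p) = shift_mat p ^\<^sub>m (p - 1)"
proof -
  let ?P = "shift_mat p" and ?Q = "shift_mat p ^\<^sub>m (p - 1)"
  have pow: "?P ^\<^sub>m p = 1\<^sub>m p"
    using assms by (intro eq_matI) (auto simp: shift_mat_pow_index)
  have QP: "?Q * ?P = 1\<^sub>m p" using pow assms by (cases p) auto
  have PQ: "?P * ?Q = 1\<^sub>m p"
    using pow_mat_commute[of ?P p "p - 1"] QP assms by simp
  show ?thesis
    unfolding mat_inv_def
  proof (rule the_equality)
    show "?Q \<in> carrier_mat (dim_col ?P) (dim_row ?P) \<and> inverts_mat ?P ?Q \<and> inverts_mat ?Q ?P"
      using assms PQ QP by (simp add: inverts_mat_def)
  next
    fix B
    assume B: "B \<in> carrier_mat (dim_col ?P) (dim_row ?P) \<and> inverts_mat ?P B \<and> inverts_mat B ?P"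
    then have "B \<in> carrier_mat p p" "?P * B = 1\<^sub>m p" by (auto simp: inverts_mat_def assms)
    then have "B = (?Q * ?P) * B" unfolding QP by simp
    also have "\<dots> = ?Q * (?P * B)"
      using assms \<open>B \<in> carrier_mat p p\<close> by (intro assoc_mult_mat[of _ p p _ p _ p]) auto
    also have "\<dots> = ?Q" using assms \<open>?P * B = 1\<^sub>m p\<close> by simp
    finally show "B = ?Q" .
  qed
qed

lemma shift_pred_pow_carrier: "0 < p \<Longrightarrow> shift_pred_pow p t \<in> carrier_mat p p"
  by (simp add: shift_pred_pow_def shift_mat_inv)

text \<open>Index 1 moves to 1 + (t - 1) = t; for t = 0 the exponent is p - 1, and 1 + (p - 1) wraps
  around to 0. Column 1 suffices because these blocks only meet a row (0, a, 0, ..., 0).\<close>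

lemma shift_pred_pow_index_1:
  assumes "2 \<le> p" "w < p" "t < p"
  shows "shift_pred_pow p t $$ (w, 1) = (if w = t then 1 else 0)"
  using assms by (auto simp: shift_pred_pow_def shift_mat_inv shift_mat_pow_index)

subsection \<open>The matrices \<open>M\<^sub>k\<^sup>\<chi>(l)\<close> and their rows\<close>

lemma M_chi_dim [simp]:
  "dim_row (M_chi TYPE('p::prime_card) k \<chi>) = theta CARD('p) k"
  "dim_col (M_chi TYPE('p::prime_card) k \<chi>) = CARD('p)"
  by (simp_all add: M_chi_def)

text \<open>Moving the condition from the index set into the summand leaves a plain range, which can
  be cut into blocks and interchanged with other sums.\<close>

lemma M_chi_index:
  assumes "i < theta CARD('p) k" "u < CARD('p)"
  shows "M_chi TYPE('p::prime_card) k \<chi> $$ (i, u) =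
    (\<Sum>j<theta CARD('p) k. if M_mat k $$ (i, j) = (of_nat u :: 'p mod_ring) then \<chi> $ j else 0)"
proof -
  let ?J = "{j. j < theta CARD('p) k \<and> M_mat k $$ (i, j) = (of_nat u :: 'p mod_ring)}"
  have "?J = {..<theta CARD('p) k} \<inter> {j. M_mat k $$ (i, j) = (of_nat u :: 'p mod_ring)}" by auto
  then show ?thesis using assms by (simp add: M_chi_def sum.inter_restrict)
qed

lemma M_chi_1_index:
  assumes "u < CARD('p)"
  shows "M_chi TYPE('p::prime_card) (Suc 0) \<chi> $$ (0, u) = (if u = 1 then \<chi> $ 0 else 0)"
proof -
  have "(1 :: 'p mod_ring) = of_nat u \<longleftrightarrow> u = 1"
    using of_nat_mod_ring_eq_iff[where 'p='p, of 1 u] assms by auto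
  with assms show ?thesis
    by (simp add: M_chi_index theta_1 prime_card_ge_2 M_mat_1)
qed

text \<open>Each entry of \<open>M_mat k\<close> equals exactly one residue u < p, so every \<chi>_j
  is counted once in the row. The total is therefore the same for all rows.\<close>

lemma M_chi_row_sum:
  assumes "i < theta CARD('p) k"
  shows "(\<Sum>u<CARD('p). M_chi TYPE('p::prime_card) k \<chi> $$ (i, u)) = (\<Sum>j<theta CARD('p) k. \<chi> $ j)"
proof -
  let ?M = "M_mat k :: 'p mod_ring mat"
  have "(\<Sum>u<CARD('p). if ?M $$ (i, j) = of_nat u then \<chi> $ j else 0) = \<chi> $ j" for j
  proof -
    obtain m where m: "m < CARD('p)" "?M $$ (i, j) = of_nat m"
      using surj_of_nat_mod_ring by blast
    then have "(if ?M $$ (i, j) = of_nat u then \<chi> $ j else 0) = (if u = m then \<chi> $ j else 0)"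
      if "u < CARD('p)" for u
      using that by (auto simp: of_nat_mod_ring_eq_iff)
    then show ?thesis using m by simp
  qed
  with assms show ?thesis
    by (simp add: M_chi_index sum.swap[of _ "{..<theta CARD('p) k}"])
qed

text \<open>A cyclic shift of a row of \<open>M\<^sub>k\<^sup>\<chi>\<close> by \<open>a\<close> counts the residues \<open>m\<^sub>i\<^sub>j + a\<close> in place of \<open>m\<^sub>i\<^sub>j\<close>.\<close>

lemma M_chi_row_shift:
  assumes "i < theta CARD('p) k" "w < CARD('p)"
  shows "(\<Sum>u<CARD('p). (if w = (u + a) mod CARD('p) then 1 else 0) * M_chi TYPE('p::prime_card) k \<chi> $$ (i, u))
    = (\<Sum>j<theta CARD('p) k. if of_nat a + M_mat k $$ (i, j) = (of_nat w :: 'p mod_ring) then \<chi> $ j else 0)"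
proof -
  let ?M = "M_mat k :: 'p mod_ring mat" and ?p = "CARD('p)"
  \<comment> \<open>For fixed j let m be the residue of the entry: only u = m contributes, and it
    lands at position w exactly when m + a is w modulo p. The sum over j is then an interchange of
    sums.\<close>
  have *: "(\<Sum>u<?p. (if w = (u + a) mod ?p then 1 else 0) * (if ?M $$ (i, j) = of_nat u then \<chi> $ j else 0))
    = (if of_nat a + ?M $$ (i, j) = (of_nat w :: 'p mod_ring) then \<chi> $ j else 0)" for j
  proof -
    obtain m where m: "m < ?p" "?M $$ (i, j) = of_nat m"
      using surj_of_nat_mod_ring by blast
    then have "(if w = (u + a) mod ?p then 1 else 0) * (if ?M $$ (i, j) = of_nat u then \<chi> $ j else 0)
      = (if u = m then if w = (m + a) mod ?p then \<chi> $ j else 0 else 0)"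
      if "u < ?p" for u
      using that by (auto simp: of_nat_mod_ring_eq_iff)
    then have "(\<Sum>u<?p. (if w = (u + a) mod ?p then 1 else 0) * (if ?M $$ (i, j) = of_nat u then \<chi> $ j else 0))
      = (if w = (m + a) mod ?p then \<chi> $ j else 0)"
      using m by simp
    also have "w = (m + a) mod ?p \<longleftrightarrow> of_nat a + ?M $$ (i, j) = (of_nat w :: 'p mod_ring)"
      using of_nat_mod_ring_eq_iff[where 'p='p, of "a + m" w] assms(2) m
      by (auto simp: add.commute)
    finally show ?thesis .
  qed
  have "(\<Sum>u<?p. (if w = (u + a) mod ?p then 1 else 0) * M_chi TYPE('p) k \<chi> $$ (i, u))
    = (\<Sum>u<?p. \<Sum>j<theta ?p k.
        (if w = (u + a) mod ?p then 1 else 0) * (if ?M $$ (i, j) = of_nat u then \<chi> $ j else 0))"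
    using assms by (intro sum.cong refl) (simp only: M_chi_index lessThan_iff sum_distrib_left)
  also have "\<dots> = (\<Sum>j<theta ?p k. \<Sum>u<?p.
        (if w = (u + a) mod ?p then 1 else 0) * (if ?M $$ (i, j) = of_nat u then \<chi> $ j else 0))"
    by (rule sum.swap)
  finally show ?thesis by (simp only: *)
qed

text \<open>The part \<chi>^(s) of the partition of \<chi>, spelled as in the recursion of
  \<open>M_chi_level\<close>; the final scalar part stays the plain entry at index
  \<open>p * \<theta>\<close>.\<close>

definition chi_part :: "nat \<Rightarrow> int vec \<Rightarrow> nat \<Rightarrow> int vec" where
  "chi_part \<theta> \<chi> s = vec \<theta> (\<lambda>i. \<chi> $ (s * \<theta> + i))"

text \<open>The columns of \<open>M_mat (Suc k)\<close> are grouped into the blocks s, with the last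
  one apart. In row (t, i) block s contributes row i of its own count matrix shifted by t s, and the
  last column has residue t. In the last row block s has constant residue s, so position w collects
  the total of \<chi>^(w). That total is any row sum; row 0 is the one that the blocks E_s
  read.\<close>

lemma M_chi_Suc_index:
  fixes k :: nat and \<chi> :: "int vec"
  defines "p \<equiv> CARD('p::prime_card)"
  defines "\<theta> \<equiv> theta p k" and "X \<equiv> M_chi TYPE('p) (Suc k) \<chi>"
  assumes k: "1 \<le> k" and w: "w < p"
  shows "t < p \<Longrightarrow> i < \<theta> \<Longrightarrow> X $$ (t * \<theta> + i, w) =
      (\<Sum>s<p. \<Sum>u<p. (if w = (u + t * s) mod p then 1 else 0) * M_chi TYPE('p) k (chi_part \<theta> \<chi> s) $$ (i, u))
      + (if w = t then \<chi> $ (p * \<theta>) else 0)"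
    and "0 < \<theta> \<Longrightarrow> X $$ (p * \<theta>, w) =
      (\<Sum>u<p. M_chi TYPE('p) k (chi_part \<theta> \<chi> w) $$ (0, u)) + (if w = 1 then \<chi> $ (p * \<theta>) else 0)"
proof -
  have p2: "2 \<le> p" by (simp add: p_def prime_card_ge_2)
  note thSuc = theta_Suc[OF p2, of k, folded \<theta>_def]
  have eq_iff: "(of_nat a :: 'p mod_ring) = of_nat b \<longleftrightarrow> a = b" if "a < p" "b < p" for a b
    using that by (simp add: of_nat_mod_ring_eq_iff p_def)
  have eq_1_iff: "(1 :: 'p mod_ring) = of_nat w \<longleftrightarrow> w = 1"
    using eq_iff[of 1 w] p2 w by auto
  note M = M_mat_Suc_index[OF k, where 'p='p, folded p_def, folded \<theta>_def]
  have split: "X $$ (i, w) =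
      (\<Sum>s<p. \<Sum>v<\<theta>. if M_mat (Suc k) $$ (i, s * \<theta> + v) = (of_nat w :: 'p mod_ring)
         then \<chi> $ (s * \<theta> + v) else 0)
      + (if M_mat (Suc k) $$ (i, p * \<theta>) = (of_nat w :: 'p mod_ring) then \<chi> $ (p * \<theta>) else 0)"
    if "i < p * \<theta> + 1" for i
    using M_chi_index[of i "Suc k" w \<chi>, where 'p='p, folded p_def] that w
    by (simp add: X_def thSuc sum_block_index)
  {
    assume t: "t < p" "i < \<theta>"
    have shift: "(\<Sum>v<\<theta>. if of_nat (t * s) + M_mat k $$ (i, v) = (of_nat w :: 'p mod_ring)
         then \<chi> $ (s * \<theta> + v) else 0) =
      (\<Sum>u<p. (if w = (u + t * s) mod p then 1 else 0) * M_chi TYPE('p) k (chi_part \<theta> \<chi> s) $$ (i, u))" for s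
      using M_chi_row_shift[where 'p='p, of i k w "t * s" "chi_part \<theta> \<chi> s", folded p_def, folded \<theta>_def] t w
      by (simp add: chi_part_def cong: if_cong del: of_nat_mult)
    have "t * \<theta> + i < p * \<theta> + 1" using block_index_less[OF t] by simp
    then have "X $$ (t * \<theta> + i, w) =
      (\<Sum>s<p. \<Sum>v<\<theta>. if of_nat (t * s) + M_mat k $$ (i, v) = (of_nat w :: 'p mod_ring)
         then \<chi> $ (s * \<theta> + v) else 0)
      + (if w = t then \<chi> $ (p * \<theta>) else 0)"
      using t w by (simp add: split M eq_iff eq_commute[of w t] del: of_nat_mult)
    then show "X $$ (t * \<theta> + i, w) =
      (\<Sum>s<p. \<Sum>u<p. (if w = (u + t * s) mod p then 1 else 0) * M_chi TYPE('p) k (chi_part \<theta> \<chi> s) $$ (i, u))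
      + (if w = t then \<chi> $ (p * \<theta>) else 0)"
      by (simp only: shift)
  next
    assume "0 < \<theta>"
    have "X $$ (p * \<theta>, w) =
      (\<Sum>s<p. \<Sum>v<\<theta>. if s = w then \<chi> $ (s * \<theta> + v) else 0) + (if w = 1 then \<chi> $ (p * \<theta>) else 0)"
      using w by (simp add: split M eq_iff eq_1_iff)
    also have "(\<Sum>s<p. \<Sum>v<\<theta>. if s = w then \<chi> $ (s * \<theta> + v) else 0)
      = (\<Sum>s<p. if s = w then \<Sum>v<\<theta>. \<chi> $ (s * \<theta> + v) else 0)"
      by (intro sum.cong) auto
    also have "\<dots> = (\<Sum>v<\<theta>. \<chi> $ (w * \<theta> + v))" using w by simp
    also have "\<dots> = (\<Sum>u<p. M_chi TYPE('p) k (chi_part \<theta> \<chi> w) $$ (0, u))"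
      using M_chi_row_sum[where 'p='p, of 0 k "chi_part \<theta> \<chi> w", folded p_def, folded \<theta>_def] \<open>0 < \<theta>\<close>
      by (simp add: chi_part_def)
    finally show "X $$ (p * \<theta>, w) =
      (\<Sum>u<p. M_chi TYPE('p) k (chi_part \<theta> \<chi> w) $$ (0, u)) + (if w = 1 then \<chi> $ (p * \<theta>) else 0)" .
  }
qed

section \<open>The recursion for the levels l\<close>

lemma M_chi_level_self: "M_chi_level TYPE('p::prime_card) k \<chi> k = M_chi TYPE('p) k \<chi>"
  by (simp add: M_chi_level.simps)

lemma M_chi_level_Suc:
  fixes l k :: nat and \<chi> :: "int vec"
  defines "\<theta> \<equiv> theta CARD('p::prime_card) k"
  assumes "l \<le> k"
  shows "M_chi_level TYPE('p) (Suc k) \<chi> l =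
    block_mat CARD('p) 1 \<theta> CARD('p) (\<lambda>s _. M_chi_level TYPE('p) k (chi_part \<theta> \<chi> s) l)
    @\<^sub>r M_chi TYPE('p) 1 (vec 1 (\<lambda>_. \<chi> $ (CARD('p) * \<theta>)))"
  using assms by (simp add: M_chi_level.simps[of _ "Suc k"] Let_def chi_part_def)

lemma M_chi_level_carrier:
  "M_chi_level TYPE('p::prime_card) k \<chi> l \<in> carrier_mat (theta CARD('p) k) CARD('p)"
proof (cases "l < k")
  case True
  then obtain k' where "k = Suc k'" "l \<le> k'" by (cases k) auto
  then show ?thesis
    by (intro carrier_matI)
      (simp_all add: M_chi_level_Suc append_rows_def theta_Suc theta_1 theta_def[of _ 0] prime_card_ge_2)
next
  case False
  then show ?thesis by (intro carrier_matI) (simp_all add: M_chi_level.simps[of _ k])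
qed

lemma M_chi_level_dim [simp]:
  "dim_row (M_chi_level TYPE('p::prime_card) k \<chi> l) = theta CARD('p) k"
  "dim_col (M_chi_level TYPE('p::prime_card) k \<chi> l) = CARD('p)"
  using M_chi_level_carrier[of k \<chi> l] by auto

lemma M_chi_level_Suc_index:
  fixes l k :: nat and \<chi> :: "int vec"
  defines "\<theta> \<equiv> theta CARD('p::prime_card) k"
  assumes "l \<le> k" "u < CARD('p)"
  shows "s < CARD('p) \<Longrightarrow> i < \<theta> \<Longrightarrow> M_chi_level TYPE('p) (Suc k) \<chi> l $$ (s * \<theta> + i, u) =
      M_chi_level TYPE('p) k (chi_part \<theta> \<chi> s) l $$ (i, u)"
    and "M_chi_level TYPE('p) (Suc k) \<chi> l $$ (CARD('p) * \<theta>, u) =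
      (if u = 1 then \<chi> $ (CARD('p) * \<theta>) else 0)"
proof -
  let ?B = "block_mat CARD('p) 1 \<theta> CARD('p) (\<lambda>s _. M_chi_level TYPE('p) k (chi_part \<theta> \<chi> s) l)"
  note eq = M_chi_level_Suc[OF assms(2), where 'p='p, of \<chi>, folded \<theta>_def]
  show "M_chi_level TYPE('p) (Suc k) \<chi> l $$ (CARD('p) * \<theta>, u) =
      (if u = 1 then \<chi> $ (CARD('p) * \<theta>) else 0)"
    using assms(3) by (simp add: eq append_rows_def M_chi_1_index theta_1 prime_card_ge_2)
  assume s: "s < CARD('p)" "i < \<theta>"
  have "?B $$ (s * \<theta> + i, 0 * CARD('p) + u) = M_chi_level TYPE('p) k (chi_part \<theta> \<chi> s) l $$ (i, u)"
    using s assms(3) by (intro index_block_mat) auto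
  with block_index_less[OF s] assms(3) show "M_chi_level TYPE('p) (Suc k) \<chi> l $$ (s * \<theta> + i, u) =
      M_chi_level TYPE('p) k (chi_part \<theta> \<chi> s) l $$ (i, u)"
    by (simp add: eq append_rows_def theta_1 prime_card_ge_2)
qed

subsection \<open>Concatenated rows as columns\<close>

lemma M_hat_carrier:
  "transpose_mat (M_hat TYPE('p::prime_card) k \<chi> l) \<in> carrier_mat (CARD('p) * theta CARD('p) k) 1"
  by (intro carrier_matI) (simp_all add: M_hat_def concat_rows_def mult.commute)

lemma M_hat_index:
  assumes "i < theta CARD('p::prime_card) k" "u < CARD('p)"
  shows "transpose_mat (M_hat TYPE('p) k \<chi> l) $$ (i * CARD('p) + u, 0) =
    M_chi_level TYPE('p) k \<chi> l $$ (i, u)"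
  using assms by (simp add: M_hat_def concat_rows_def block_index_less)

text \<open>The first p blocks come from the parts \<chi>^(s); the tail comes from the scalar part
  and is the same for every l \<le> k. The bound includes l = k, the level directly below the top,
  to which the diagonal matrix is applied.\<close>

lemma M_hat_Suc_index:
  fixes l k :: nat and \<chi> :: "int vec"
  defines "p \<equiv> CARD('p::prime_card)"
  defines "\<theta> \<equiv> theta p k" and "X \<equiv> transpose_mat (M_hat TYPE('p) (Suc k) \<chi> l)"
  assumes "l \<le> k"
  shows "s < p \<Longrightarrow> r < p * \<theta> \<Longrightarrow> X $$ (s * (p * \<theta>) + r, 0) =
      transpose_mat (M_hat TYPE('p) k (chi_part \<theta> \<chi> s) l) $$ (r, 0)"
    and "u < p \<Longrightarrow> X $$ (p * (p * \<theta>) + u, 0) = (if u = 1 then \<chi> $ (p * \<theta>) else 0)"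
proof -
  have thSuc: "theta p (Suc k) = p * \<theta> + 1"
    by (simp add: p_def \<theta>_def theta_Suc prime_card_ge_2)
  note idx = M_hat_index[where 'p='p, folded p_def]
  note lev = M_chi_level_Suc_index[OF assms(4), where 'p='p, folded p_def, folded \<theta>_def]
  {
    assume s: "s < p" "r < p * \<theta>"
    then obtain i u where r: "i < \<theta>" "u < p" "r = i * p + u"
      by (metis block_index_cases mult.commute)
    have "s * \<theta> + i < theta p (Suc k)" using block_index_less[OF s(1) r(1)] by (simp add: thSuc)
    then have "X $$ ((s * \<theta> + i) * p + u, 0) = M_chi_level TYPE('p) k (chi_part \<theta> \<chi> s) l $$ (i, u)"
      using r s unfolding X_def by (simp add: idx lev)
    also have "\<dots> = transpose_mat (M_hat TYPE('p) k (chi_part \<theta> \<chi> s) l) $$ (r, 0)"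
      using r by (simp add: idx \<theta>_def)
    also have "(s * \<theta> + i) * p + u = s * (p * \<theta>) + r" by (simp add: r algebra_simps)
    finally show "X $$ (s * (p * \<theta>) + r, 0) =
      transpose_mat (M_hat TYPE('p) k (chi_part \<theta> \<chi> s) l) $$ (r, 0)" .
  next
    assume u: "u < p"
    have "X $$ ((p * \<theta>) * p + u, 0) = (if u = 1 then \<chi> $ (p * \<theta>) else 0)"
      using u unfolding X_def by (simp add: idx lev thSuc del: mult.assoc)
    then show "X $$ (p * (p * \<theta>) + u, 0) = (if u = 1 then \<chi> $ (p * \<theta>) else 0)"
      by (simp add: mult.commute)
  }
qed

subsection \<open>The matrices \<open>T\<^sub>k\<^sub>,\<^sub>l\<close>\<close>

text \<open>
  \<open>T\<^sub>2\<^sub>,\<^sub>2\<close> and \<open>T\<^sub>k\<^sub>,\<^sub>k\<close> differ only in the corner block \<open>D\<close>.  It is multiplied by a multiple of the unit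
  vector with index 1, which both \<open>E\<^sub>1\<close> and \<open>I\<^sub>p\<close> fix.
\<close>

definition T_diag :: "nat \<Rightarrow> nat \<Rightarrow> int mat \<Rightarrow> int mat" where
  "T_diag p \<theta> D =
      four_block_mat
        (block_mat p p (p * \<theta>) (p * \<theta>) (\<lambda>t s. 1\<^sub>m \<theta> \<otimes>\<^sub>k shift_mat p ^\<^sub>m (t * s)))
        (block_mat p 1 (p * \<theta>) p (\<lambda>t _. mat \<theta> 1 (\<lambda>_. 1) \<otimes>\<^sub>k shift_pred_pow p t))
        (block_mat 1 p p (p * \<theta>)
           (\<lambda>_ s. mat p (p * \<theta>) (\<lambda>(i, j). if j < p then E_mat p s $$ (i, j) else 0)))
        D"

lemma kronecker_1x1:
  assumes "dim_row B = 1" "dim_col B = 1" "B $$ (0, 0) = 1"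
  shows "B \<otimes>\<^sub>k A = A"
  using assms by (intro eq_matI) (auto simp: kronecker_def block_mat_def)

text \<open>For \<theta> = 1 the left Kronecker factors are 1 x 1 with entry 1, and the zero padding
  beside E_s is empty, so the general diagonal shape specializes to the case k = 2.\<close>

lemma T22_mat_eq:
  assumes "0 < p"
  shows "T22_mat p = T_diag p 1 (E_mat p 1)"
proof -
  have "mat p p (\<lambda>(i, j). if j < p then E_mat p s $$ (i, j) else 0) = E_mat p s" for s
    by (rule eq_matI) (simp_all add: E_mat_def)
  then show ?thesis by (simp add: T22_mat_def T_diag_def kronecker_1x1)
qed

lemma Tkk_mat_eq: "Tkk_mat p k = T_diag p (theta p (k - 1)) (1\<^sub>m p)"
  by (simp add: Tkk_mat_def T_diag_def Let_def)

lemma T_diag_carrier: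
  "D \<in> carrier_mat p p \<Longrightarrow> T_diag p \<theta> D \<in> carrier_mat (p * (p * \<theta>) + p) (p * (p * \<theta>) + p)"
  by (intro carrier_matI) (auto simp: T_diag_def)

text \<open>A row in block row t is addressed as t (p \<theta>) + (i p + w), with i the index in the
  left Kronecker factor and w the one in the p x p factor, and columns likewise. The identity factor
  forces i = v, and the power of P gives w = u + t s modulo p. The four claims are the four corners
  of the block matrix.\<close>

lemma T_diag_index:
  assumes D: "D \<in> carrier_mat p p"
  shows "t < p \<Longrightarrow> i < \<theta> \<Longrightarrow> w < p \<Longrightarrow> s < p \<Longrightarrow> v < \<theta> \<Longrightarrow> u < p \<Longrightarrow>
      T_diag p \<theta> D $$ (t * (p * \<theta>) + (i * p + w), s * (p * \<theta>) + (v * p + u)) =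
      (if i = v \<and> w = (u + t * s) mod p then 1 else 0)"
    and "t < p \<Longrightarrow> i < \<theta> \<Longrightarrow> w < p \<Longrightarrow> u < p \<Longrightarrow>
      T_diag p \<theta> D $$ (t * (p * \<theta>) + (i * p + w), p * (p * \<theta>) + u) = shift_pred_pow p t $$ (w, u)"
    and "w < p \<Longrightarrow> s < p \<Longrightarrow> r < p * \<theta> \<Longrightarrow>
      T_diag p \<theta> D $$ (p * (p * \<theta>) + w, s * (p * \<theta>) + r) = (if r < p \<and> w = s then 1 else 0)"
    and "w < p \<Longrightarrow> u < p \<Longrightarrow>
      T_diag p \<theta> D $$ (p * (p * \<theta>) + w, p * (p * \<theta>) + u) = D $$ (w, u)"
proof -
  let ?A = "block_mat p p (p * \<theta>) (p * \<theta>) (\<lambda>t s. 1\<^sub>m \<theta> \<otimes>\<^sub>k shift_mat p ^\<^sub>m (t * s))"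
  let ?B = "block_mat p 1 (p * \<theta>) p (\<lambda>t _. mat \<theta> 1 (\<lambda>_. 1) \<otimes>\<^sub>k shift_pred_pow p t)"
  let ?C = "block_mat 1 p p (p * \<theta>)
    (\<lambda>_ s. mat p (p * \<theta>) (\<lambda>(i, j). if j < p then E_mat p s $$ (i, j) else 0))"
  have inner: "i * p + w < p * \<theta>" if "i < \<theta>" "w < p" for i w
    using block_index_less[OF that] by (simp add: mult.commute)
  {
    assume h: "t < p" "i < \<theta>" "w < p"
    then have "0 < p" by simp
    from h have row: "t * (p * \<theta>) + (i * p + w) < p * (p * \<theta>)"
      by (intro block_index_less inner)
    {
      assume h': "s < p" "v < \<theta>" "u < p"
      then have col: "s * (p * \<theta>) + (v * p + u) < p * (p * \<theta>)"
        by (intro block_index_less inner)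
      have "?A $$ (t * (p * \<theta>) + (i * p + w), s * (p * \<theta>) + (v * p + u))
        = (1\<^sub>m \<theta> \<otimes>\<^sub>k shift_mat p ^\<^sub>m (t * s)) $$ (i * p + w, v * p + u)"
        using h h' by (intro index_block_mat inner)
      also have "\<dots> = 1\<^sub>m \<theta> $$ (i, v) * (shift_mat p ^\<^sub>m (t * s)) $$ (w, u)"
        by (rule index_kronecker[OF one_carrier_mat shift_mat_pow_carrier[OF \<open>0 < p\<close>] h(2) h'(2) h(3) h'(3)])
      also have "\<dots> = (if i = v \<and> w = (u + t * s) mod p then 1 else 0)"
        using h h' by (simp add: shift_mat_pow_index)
      finally show "T_diag p \<theta> D $$ (t * (p * \<theta>) + (i * p + w), s * (p * \<theta>) + (v * p + u)) =
          (if i = v \<and> w = (u + t * s) mod p then 1 else 0)"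
        using row col D by (simp add: T_diag_def)
    next
      assume u: "u < p"
      have "?B $$ (t * (p * \<theta>) + (i * p + w), 0 * p + u)
        = (mat \<theta> 1 (\<lambda>_. 1) \<otimes>\<^sub>k shift_pred_pow p t) $$ (i * p + w, u)"
        using h u by (intro index_block_mat inner) auto
      also have "\<dots> = shift_pred_pow p t $$ (w, u)"
        \<comment> \<open>The left factor is a single column of ones, so its column index is 0; the
          \<open>less_one\<close> instance supplies 0 < 1.\<close>
        using index_kronecker[of "mat \<theta> 1 (\<lambda>_. 1)" \<theta> 1, OF mat_carrier
            shift_pred_pow_carrier[OF \<open>0 < p\<close>, of t] h(2) less_one[THEN iffD2, OF refl] h(3) u] h(2)
        by simp
      finally show "T_diag p \<theta> D $$ (t * (p * \<theta>) + (i * p + w), p * (p * \<theta>) + u) =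
          shift_pred_pow p t $$ (w, u)"
        using row u D by (simp add: T_diag_def)
    }
  next
    assume w: "w < p"
    {
      assume h: "s < p" "r < p * \<theta>"
      have "?C $$ (0 * p + w, s * (p * \<theta>) + r)
        = mat p (p * \<theta>) (\<lambda>(i, j). if j < p then E_mat p s $$ (i, j) else 0) $$ (w, r)"
        using w h by (intro index_block_mat) auto
      then show "T_diag p \<theta> D $$ (p * (p * \<theta>) + w, s * (p * \<theta>) + r) =
          (if r < p \<and> w = s then 1 else 0)"
        using w h block_index_less[OF h] D by (simp add: T_diag_def E_mat_def)
    next
      assume "u < p"
      then show "T_diag p \<theta> D $$ (p * (p * \<theta>) + w, p * (p * \<theta>) + u) = D $$ (w, u)"
        using w D by (simp add: T_diag_def)
    }
  }
qed

text \<open>X ends in a times unit vector 1, so only column 1 of the last block column counts, and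
  this is all that is asked of D. A row (t, i) meets only v = i in each block, and the bottom block
  row picks out the first p entries of block w.\<close>

lemma T_diag_mult_index:
  fixes X :: "int mat" and a :: int
  assumes p: "2 \<le> p" and "0 < \<theta>" and D: "D \<in> carrier_mat p p"
    and D1: "\<And>w. w < p \<Longrightarrow> D $$ (w, 1) = (if w = 1 then 1 else 0)"
    and X: "X \<in> carrier_mat (p * (p * \<theta>) + p) 1"
    and X_last: "\<And>u. u < p \<Longrightarrow> X $$ (p * (p * \<theta>) + u, 0) = (if u = 1 then a else 0)"
    and w: "w < p"
  shows "t < p \<Longrightarrow> i < \<theta> \<Longrightarrow> (T_diag p \<theta> D * X) $$ (t * (p * \<theta>) + (i * p + w), 0) =
      (\<Sum>s<p. \<Sum>u<p. (if w = (u + t * s) mod p then 1 else 0) * X $$ (s * (p * \<theta>) + (i * p + u), 0))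
      + (if w = t then a else 0)"
    and "(T_diag p \<theta> D * X) $$ (p * (p * \<theta>) + w, 0) =
      (\<Sum>u<p. X $$ (w * (p * \<theta>) + u, 0)) + (if w = 1 then a else 0)"
proof -
  let ?T = "T_diag p \<theta> D"
  note T = T_diag_index[OF D, where \<theta>=\<theta>]
  \<comment> \<open>The sum is cut along the triple index (s, v, u), and the tail reduces to u =
    1.\<close>
  have split: "(?T * X) $$ (r, 0) =
      (\<Sum>s<p. \<Sum>v<\<theta>. \<Sum>u<p. ?T $$ (r, s * (p * \<theta>) + (v * p + u)) * X $$ (s * (p * \<theta>) + (v * p + u), 0))
      + ?T $$ (r, p * (p * \<theta>) + 1) * a"
    if "r < p * (p * \<theta>) + p" for r
  proof -
    have inner: "(\<Sum>c<p * \<theta>. ?T $$ (r, s * (p * \<theta>) + c) * X $$ (s * (p * \<theta>) + c, 0))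
      = (\<Sum>v<\<theta>. \<Sum>u<p. ?T $$ (r, s * (p * \<theta>) + (v * p + u)) * X $$ (s * (p * \<theta>) + (v * p + u), 0))" for s
      using sum_block_index[of "\<lambda>c. ?T $$ (r, s * (p * \<theta>) + c) * X $$ (s * (p * \<theta>) + c, 0)" \<theta> p]
      by (simp only: mult.commute[of p \<theta>])
    have "(?T * X) $$ (r, 0) = (\<Sum>c<p * (p * \<theta>) + p. ?T $$ (r, c) * X $$ (c, 0))"
      using that by (intro index_mult_mat_sum[OF T_diag_carrier[OF D] X]) auto
    also have "\<dots> = (\<Sum>s<p. \<Sum>c<p * \<theta>. ?T $$ (r, s * (p * \<theta>) + c) * X $$ (s * (p * \<theta>) + c, 0))
      + (\<Sum>u<p. ?T $$ (r, p * (p * \<theta>) + u) * X $$ (p * (p * \<theta>) + u, 0))"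
      by (simp only: sum_lessThan_add sum_block_index)
    also have "(\<Sum>u<p. ?T $$ (r, p * (p * \<theta>) + u) * X $$ (p * (p * \<theta>) + u, 0))
      = (\<Sum>u<p. if u = 1 then ?T $$ (r, p * (p * \<theta>) + 1) * a else 0)"
      by (intro sum.cong) (auto simp: X_last)
    also have "\<dots> = ?T $$ (r, p * (p * \<theta>) + 1) * a" using p by simp
    finally show ?thesis by (simp only: inner)
  qed
  {
    assume t: "t < p" "i < \<theta>"
    have "i * p + w < p * \<theta>" using block_index_less[OF t(2) w] by (simp add: mult.commute)
    from block_index_less[OF t(1) this]
    have "t * (p * \<theta>) + (i * p + w) < p * (p * \<theta>) + p" by simp
    note split[OF this]
    also have "?T $$ (t * (p * \<theta>) + (i * p + w), p * (p * \<theta>) + 1) * a = (if w = t then a else 0)"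
      using t w p T(2)[of t i w 1] shift_pred_pow_index_1[of p w t] by simp
    \<comment> \<open>The identity factor leaves only v = i.\<close>
    also have "(\<Sum>s<p. \<Sum>v<\<theta>. \<Sum>u<p. ?T $$ (t * (p * \<theta>) + (i * p + w), s * (p * \<theta>) + (v * p + u))
        * X $$ (s * (p * \<theta>) + (v * p + u), 0))
      = (\<Sum>s<p. \<Sum>v<\<theta>. if v = i then \<Sum>u<p. (if w = (u + t * s) mod p then 1 else 0)
        * X $$ (s * (p * \<theta>) + (i * p + u), 0) else 0)"
      using t w by (intro sum.cong) (auto simp: T(1) intro!: sum.cong sum.neutral)
    also have "\<dots> = (\<Sum>s<p. \<Sum>u<p. (if w = (u + t * s) mod p then 1 else 0)
        * X $$ (s * (p * \<theta>) + (i * p + u), 0))"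
      using t by simp
    finally show "(?T * X) $$ (t * (p * \<theta>) + (i * p + w), 0) =
      (\<Sum>s<p. \<Sum>u<p. (if w = (u + t * s) mod p then 1 else 0) * X $$ (s * (p * \<theta>) + (i * p + u), 0))
      + (if w = t then a else 0)" .
  }
  \<comment> \<open>E_s occupies only the first p columns of its block, so in the bottom rows only v
    = 0 survives.\<close>
  have first_row: "v * p + u < p \<longleftrightarrow> v = 0" if "u < p" for u v
    using that by (cases v) auto
  have inner: "v * p + u < p * \<theta>" if "v < \<theta>" "u < p" for v u
    using block_index_less[OF that] by (simp add: mult.commute)
  have row: "(\<Sum>u<p. ?T $$ (p * (p * \<theta>) + w, s * (p * \<theta>) + (v * p + u)) * X $$ (s * (p * \<theta>) + (v * p + u), 0))
    = (if s = w then if v = 0 then \<Sum>u<p. X $$ (w * (p * \<theta>) + u, 0) else 0 else 0)"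
    if "s < p" "v < \<theta>" for s v
    using that w by (auto simp: T(3) inner first_row cong: sum.cong_simp)
  have "p * (p * \<theta>) + w < p * (p * \<theta>) + p" using w by simp
  note split[OF this]
  also have "?T $$ (p * (p * \<theta>) + w, p * (p * \<theta>) + 1) * a = (if w = 1 then a else 0)"
    using w p T(4)[of w 1] D1 by simp
  also have "(\<Sum>s<p. \<Sum>v<\<theta>. \<Sum>u<p. ?T $$ (p * (p * \<theta>) + w, s * (p * \<theta>) + (v * p + u))
        * X $$ (s * (p * \<theta>) + (v * p + u), 0))
    = (\<Sum>s<p. if s = w then \<Sum>v<\<theta>. if v = 0 then \<Sum>u<p. X $$ (w * (p * \<theta>) + u, 0) else 0 else 0)"
    by (intro sum.cong refl) (simp add: row cong: sum.cong_simp)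
  also have "\<dots> = (\<Sum>u<p. X $$ (w * (p * \<theta>) + u, 0))" using w \<open>0 < \<theta>\<close> by simp
  finally show "(?T * X) $$ (p * (p * \<theta>) + w, 0) =
      (\<Sum>u<p. X $$ (w * (p * \<theta>) + u, 0)) + (if w = 1 then a else 0)" .
qed

section \<open>The diagonal case k = l\<close>

lemma column_eqI:
  fixes X Y :: "'a mat"
  assumes "X \<in> carrier_mat (m * a + b) 1" "Y \<in> carrier_mat (m * a + b) 1"
    and "\<And>s r. s < m \<Longrightarrow> r < a \<Longrightarrow> X $$ (s * a + r, 0) = Y $$ (s * a + r, 0)"
    and "\<And>u. u < b \<Longrightarrow> X $$ (m * a + u, 0) = Y $$ (m * a + u, 0)"
  shows "X = Y"
proof (rule eq_matI)
  fix r c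
  assume "r < dim_row Y" "c < dim_col Y"
  then have "r < m * a + b" "c = 0" using assms(2) by auto
  show "X $$ (r, c) = Y $$ (r, c)"
  proof (cases "r < m * a")
    case True
    then show ?thesis using assms(3) \<open>c = 0\<close> by (elim block_index_cases) simp
  next
    case False
    then show ?thesis using assms(4)[of "r - m * a"] \<open>r < m * a + b\<close> \<open>c = 0\<close> by simp
  qed
qed (use assms in auto)

text \<open>One level below the top, the entries of the vector are those of the matrices
  \<open>M_chi\<close> of the parts, so \<open>M_chi_Suc_index\<close> and
  \<open>T_diag_mult_index\<close> produce the same sums. D stays general to treat both forms of the
  corner at once.\<close>

lemma M_hat_T_diag:
  fixes k :: nat and \<chi> :: "int vec"
  defines "p \<equiv> CARD('p::prime_card)"
  assumes k: "1 \<le> k" and D: "D \<in> carrier_mat p p"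
    and D1: "\<And>w. w < p \<Longrightarrow> D $$ (w, 1) = (if w = 1 then 1 else 0)"
  shows "transpose_mat (M_hat TYPE('p) (Suc k) \<chi> (Suc k)) =
    T_diag p (theta p k) D * transpose_mat (M_hat TYPE('p) (Suc k) \<chi> k)"
proof -
  define \<theta> where "\<theta> = theta p k"
  define X where "X = transpose_mat (M_hat TYPE('p) (Suc k) \<chi> k)"
  define Y where "Y = transpose_mat (M_hat TYPE('p) (Suc k) \<chi> (Suc k))"
  have p2: "2 \<le> p" by (simp add: p_def prime_card_ge_2)
  have thSuc: "theta p (Suc k) = p * \<theta> + 1" by (simp add: theta_Suc p2 \<theta>_def)
  have "0 < \<theta>" using k theta_Suc[OF p2] by (cases k) (auto simp: \<theta>_def)
  have carr: "transpose_mat (M_hat TYPE('p) (Suc k) \<chi> l) \<in> carrier_mat (p * (p * \<theta>) + p) 1" for l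
    using M_hat_carrier[of "Suc k" \<chi> l, where 'p='p] thSuc by (simp add: p_def algebra_simps)
  have Xblock: "X $$ (s * (p * \<theta>) + (i * p + u), 0) = M_chi TYPE('p) k (chi_part \<theta> \<chi> s) $$ (i, u)"
    if "s < p" "i < \<theta>" "u < p" for s i u
    using M_hat_Suc_index(1)[OF le_refl, where 'p='p and k=k, folded p_def, folded \<theta>_def]
      M_hat_index[where 'p='p, folded p_def] that block_index_less[OF that(2,3)]
    by (simp add: X_def M_chi_level_self \<theta>_def mult.commute)
  have Xlast: "X $$ (p * (p * \<theta>) + u, 0) = (if u = 1 then \<chi> $ (p * \<theta>) else 0)" if "u < p" for u
    using M_hat_Suc_index(2)[OF le_refl, where 'p='p and k=k, folded p_def, folded \<theta>_def] that
    by (simp add: X_def)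
  have Yidx: "Y $$ (i * p + w, 0) = M_chi TYPE('p) (Suc k) \<chi> $$ (i, w)"
    if "i < p * \<theta> + 1" "w < p" for i w
    using M_hat_index[where 'p='p, of i "Suc k" w, folded p_def] that
    by (simp add: Y_def M_chi_level_self thSuc)
  note chi = M_chi_Suc_index[OF k, where 'p='p, folded p_def, folded \<theta>_def]
  note TX = T_diag_mult_index[OF p2 \<open>0 < \<theta>\<close> D D1 carr[of k, folded X_def] Xlast]
  have "Y = T_diag p \<theta> D * X"
  proof (rule column_eqI)
    show "Y \<in> carrier_mat (p * (p * \<theta>) + p) 1" unfolding Y_def by (rule carr)
    show "T_diag p \<theta> D * X \<in> carrier_mat (p * (p * \<theta>) + p) 1"
      using T_diag_carrier[OF D] carr unfolding X_def by (rule mult_carrier_mat)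
  next
    fix t r
    assume t: "t < p" and "r < p * \<theta>"
    then obtain i w where r: "i < \<theta>" "w < p" "r = i * p + w"
      by (metis block_index_cases mult.commute)
    have idx: "t * (p * \<theta>) + r = (t * \<theta> + i) * p + w" by (simp add: r algebra_simps)
    have "Y $$ (t * (p * \<theta>) + r, 0) = M_chi TYPE('p) (Suc k) \<chi> $$ (t * \<theta> + i, w)"
      unfolding idx using Yidx[of "t * \<theta> + i" w] block_index_less[OF t r(1)] r by simp
    also have "\<dots> = (T_diag p \<theta> D * X) $$ (t * (p * \<theta>) + r, 0)"
      unfolding r(3) using t r by (subst chi(1), simp, simp, simp, subst TX(1)) (simp_all add: Xblock)
    finally show "Y $$ (t * (p * \<theta>) + r, 0) = (T_diag p \<theta> D * X) $$ (t * (p * \<theta>) + r, 0)" .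
  next
    fix w
    assume w: "w < p"
    have idx: "p * (p * \<theta>) + w = (p * \<theta>) * p + w" by (simp add: mult.commute)
    have "Y $$ (p * (p * \<theta>) + w, 0) = M_chi TYPE('p) (Suc k) \<chi> $$ (p * \<theta>, w)"
      unfolding idx using Yidx[of "p * \<theta>" w] w by simp
    also have "\<dots> = (T_diag p \<theta> D * X) $$ (p * (p * \<theta>) + w, 0)"
      using w \<open>0 < \<theta>\<close> Xblock[of w 0] by (simp add: chi(2) TX(2))
    finally show "Y $$ (p * (p * \<theta>) + w, 0) = (T_diag p \<theta> D * X) $$ (p * (p * \<theta>) + w, 0)" .
  qed
  then show ?thesis by (simp add: X_def Y_def \<theta>_def)
qed

text \<open>Hides which diagonal case applies: the corner is E_1 for k = 1 and the identity
  otherwise, and only its column 1 is passed on.\<close>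

lemma T_mat_self:
  assumes "2 \<le> p" "1 \<le> k"
  obtains D where "D \<in> carrier_mat p p" "\<And>w. w < p \<Longrightarrow> D $$ (w, 1) = (if w = 1 then 1 else 0)"
    "T_mat p (Suc k) (Suc k) = T_diag p (theta p k) D"
proof (cases "k = 1")
  case True
  have "T_mat p (Suc k) (Suc k) = T_diag p (theta p k) (E_mat p 1)"
    using assms by (subst T_mat.simps) (simp add: True T22_mat_eq theta_1)
  then show ?thesis
    by (rule that[rotated 2]) (use assms in \<open>auto simp: E_mat_def\<close>)
next
  case False
  show ?thesis
    by (rule that[of "1\<^sub>m p"])
      (use assms False in \<open>auto simp: T_mat.simps[of p "Suc k"] Tkk_mat_eq\<close>)
qed

section \<open>The block-diagonal case k > l and the induction on k\<close>

lemma T_mat_less: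
  assumes "l \<le> k"
  shows "T_mat p (Suc k) l =
    four_block_mat (1\<^sub>m p \<otimes>\<^sub>k T_mat p k l) (0\<^sub>m (p * (p * theta p k)) p)
      (0\<^sub>m p (p * (p * theta p k))) (1\<^sub>m p)"
  using assms by (simp add: T_mat.simps[of p "Suc k"] Let_def)

lemma T_mat_carrier:
  assumes "2 \<le> p" "2 \<le> l" "l \<le> k"
  shows "T_mat p k l \<in> carrier_mat (p * theta p k) (p * theta p k)"
  using assms(3)
proof (induction k rule: dec_induct)
  case base
  obtain k' where l: "l = Suc k'" "1 \<le> k'" using assms(2) by (cases l) auto
  obtain D where D: "D \<in> carrier_mat p p" "T_mat p (Suc k') (Suc k') = T_diag p (theta p k') D"
    using T_mat_self[OF assms(1) l(2)] by metis
  then show ?case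
    using T_diag_carrier[OF D(1), of "theta p k'"] by (simp add: l theta_Suc assms(1) algebra_simps)
next
  case (step k)
  then show ?case
    by (intro carrier_matI) (auto simp: T_mat_less theta_Suc assms(1) algebra_simps)
qed

text \<open>Induction on k starting at k = l, with \<chi> arbitrary since the hypothesis is applied
  to each part \<chi>^(s). The base is the diagonal case. In the step both vectors split into p
  blocks, on which the smaller T acts separately, and they share the last p entries.\<close>

lemma M_hat_step:
  fixes \<chi> :: "int vec"
  defines "p \<equiv> CARD('p::prime_card)"
  assumes l: "2 \<le> l" and "l \<le> k"
  shows "transpose_mat (M_hat TYPE('p) k \<chi> l) =
    T_mat p k l * transpose_mat (M_hat TYPE('p) k \<chi> (l - 1))"
  using \<open>l \<le> k\<close>
proof (induction k arbitrary: \<chi> rule: dec_induct)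
  case base
  have p2: "2 \<le> p" by (simp add: p_def prime_card_ge_2)
  obtain k where k: "l = Suc k" "1 \<le> k" using l by (cases l) auto
  obtain D where "D \<in> carrier_mat p p" "\<And>w. w < p \<Longrightarrow> D $$ (w, 1) = (if w = 1 then 1 else 0)"
    "T_mat p (Suc k) (Suc k) = T_diag p (theta p k) D"
    using T_mat_self[OF p2 k(2)] by metis
  with M_hat_T_diag[where 'p='p, folded p_def, OF k(2)] show ?case by (simp add: k)
next
  case (step k)
  have p2: "2 \<le> p" by (simp add: p_def prime_card_ge_2)
  define \<theta> where "\<theta> = theta p k"
  define T where "T = T_mat p k l"
  define h where "h \<chi> j = transpose_mat (M_hat TYPE('p) k \<chi> j)" for \<chi> :: "int vec" and j
  define Y X where "Y = transpose_mat (M_hat TYPE('p) (Suc k) \<chi> l)"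
    and "X = transpose_mat (M_hat TYPE('p) (Suc k) \<chi> (l - 1))"
  have thSuc: "theta p (Suc k) = p * \<theta> + 1" by (simp add: theta_Suc p2 \<theta>_def)
  have carr: "transpose_mat (M_hat TYPE('p) (Suc k) \<chi> j) \<in> carrier_mat (p * (p * \<theta>) + p) 1" for j
    using M_hat_carrier[of "Suc k" \<chi> j, where 'p='p] thSuc by (simp add: p_def algebra_simps)
  have hcarr: "h \<chi> j \<in> carrier_mat (p * \<theta>) 1" for \<chi> j
    using M_hat_carrier[of k \<chi> j, where 'p='p] by (simp add: h_def p_def \<theta>_def)
  have Tcarr: "T \<in> carrier_mat (p * \<theta>) (p * \<theta>)"
    using T_mat_carrier[OF p2 l step(1)] by (simp add: T_def \<theta>_def)
  have Tk: "T_mat p (Suc k) l = four_block_mat (1\<^sub>m p \<otimes>\<^sub>k T) (0\<^sub>m (p * (p * \<theta>)) p)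
      (0\<^sub>m p (p * (p * \<theta>))) (1\<^sub>m p)" (is "_ = ?T")
    using T_mat_less[OF step(1)] by (simp add: T_def \<theta>_def)
  have T'carr: "?T \<in> carrier_mat (p * (p * \<theta>) + p) (p * (p * \<theta>) + p)"
    using Tcarr by (intro carrier_matI) auto
  have dims: "dim_row T = p * \<theta>" "dim_col T = p * \<theta>" using Tcarr by auto
  have Tidx: "?T $$ (s * (p * \<theta>) + r, s' * (p * \<theta>) + r') = (if s = s' then T $$ (r, r') else 0)"
    if "s < p" "r < p * \<theta>" "s' < p" "r' < p * \<theta>" for s r s' r'
    using index_kronecker[OF one_carrier_mat Tcarr that(1,3,2,4)] that
      block_index_less[OF that(1,2)] block_index_less[OF that(3,4)] by (simp add: dims)
  have Tzero: "?T $$ (s * (p * \<theta>) + r, p * (p * \<theta>) + u) = 0" "?T $$ (p * (p * \<theta>) + u, s * (p * \<theta>) + r) = 0"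
    if "s < p" "r < p * \<theta>" "u < p" for s r u
    using that block_index_less[OF that(1,2)] by (simp_all add: dims)
  have Tone: "?T $$ (p * (p * \<theta>) + u, p * (p * \<theta>) + u') = (if u = u' then 1 else 0)"
    if "u < p" "u' < p" for u u'
    using that by (simp add: dims)
  have idx: "transpose_mat (M_hat TYPE('p) (Suc k) \<chi> j) $$ (s * (p * \<theta>) + r, 0) = h (chi_part \<theta> \<chi> s) j $$ (r, 0)"
    if "j \<le> k" "s < p" "r < p * \<theta>" for j s r
    using M_hat_Suc_index(1)[where 'p='p and k=k, folded p_def, folded \<theta>_def, OF that] by (simp add: h_def)
  have idx_last: "transpose_mat (M_hat TYPE('p) (Suc k) \<chi> j) $$ (p * (p * \<theta>) + u, 0) = (if u = 1 then \<chi> $ (p * \<theta>) else 0)"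
    if "j \<le> k" "u < p" for j u
    using M_hat_Suc_index(2)[where 'p='p and k=k, folded p_def, folded \<theta>_def, OF that] .
  \<comment> \<open>Both levels lie below k + 1, so here both sides follow the recursion; in the
    base case only the right-hand side does.\<close>
  have le: "l \<le> k" "l - 1 \<le> k" using step(1) by auto
  have split: "(?T * X) $$ (r, 0) =
      (\<Sum>s<p. \<Sum>c<p * \<theta>. ?T $$ (r, s * (p * \<theta>) + c) * X $$ (s * (p * \<theta>) + c, 0))
      + (\<Sum>u<p. ?T $$ (r, p * (p * \<theta>) + u) * X $$ (p * (p * \<theta>) + u, 0))"
    if "r < p * (p * \<theta>) + p" for r
    using index_mult_mat_sum[OF T'carr carr[of "l - 1", folded X_def] that, of 0]
    by (simp only: sum_lessThan_add sum_block_index)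
  have "Y = ?T * X"
  proof (rule column_eqI)
    show "Y \<in> carrier_mat (p * (p * \<theta>) + p) 1" unfolding Y_def by (rule carr)
    show "?T * X \<in> carrier_mat (p * (p * \<theta>) + p) 1"
      using T'carr carr unfolding X_def by (rule mult_carrier_mat)
  next
    fix s r
    assume s: "s < p" "r < p * \<theta>"
    have "Y $$ (s * (p * \<theta>) + r, 0) = (T * h (chi_part \<theta> \<chi> s) (l - 1)) $$ (r, 0)"
      using step(3)[of "chi_part \<theta> \<chi> s"] s le by (simp add: Y_def idx) (simp add: h_def T_def)
    also have "\<dots> = (\<Sum>c<p * \<theta>. T $$ (r, c) * X $$ (s * (p * \<theta>) + c, 0))"
      using index_mult_mat_sum[OF Tcarr hcarr s(2), of 0] s le by (simp add: X_def idx del: index_mult_mat)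
    \<comment> \<open>The single block is padded to a sum over all s', to match the zero
      off-diagonal blocks.\<close>
    also have "\<dots> = (\<Sum>s'<p. if s' = s then \<Sum>c<p * \<theta>. T $$ (r, c) * X $$ (s * (p * \<theta>) + c, 0) else 0)"
      using s by simp
    also have "\<dots> = (\<Sum>s'<p. \<Sum>c<p * \<theta>. ?T $$ (s * (p * \<theta>) + r, s' * (p * \<theta>) + c) * X $$ (s' * (p * \<theta>) + c, 0))"
      using s by (intro sum.cong) (auto simp: Tidx simp del: index_mat_four_block)
    also have "\<dots> = (?T * X) $$ (s * (p * \<theta>) + r, 0)"
      using block_index_less[OF s] s by (simp add: split Tzero del: index_mat_four_block index_mult_mat)
    finally show "Y $$ (s * (p * \<theta>) + r, 0) = (?T * X) $$ (s * (p * \<theta>) + r, 0)" .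
  next
    fix u
    assume u: "u < p"
    \<comment> \<open>The identity corner copies the tail, which does not depend on the
      level.\<close>
    have "(?T * X) $$ (p * (p * \<theta>) + u, 0) = (\<Sum>u'<p. ?T $$ (p * (p * \<theta>) + u, p * (p * \<theta>) + u') * X $$ (p * (p * \<theta>) + u', 0))"
      using u by (simp add: split Tzero del: index_mat_four_block index_mult_mat)
    also have "\<dots> = (\<Sum>u'<p. if u' = u then X $$ (p * (p * \<theta>) + u, 0) else 0)"
      using u by (intro sum.cong) (auto simp: Tone simp del: index_mat_four_block)
    also have "\<dots> = Y $$ (p * (p * \<theta>) + u, 0)"
      using u le by (simp add: X_def Y_def idx_last)
    finally show "Y $$ (p * (p * \<theta>) + u, 0) = (?T * X) $$ (p * (p * \<theta>) + u, 0)" by simp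
  qed
  then show ?case by (simp add: X_def Y_def Tk)
qed

section \<open>The product formula\<close>

lemma foldr_mult_carrier:
  assumes "\<And>A. A \<in> set As \<Longrightarrow> A \<in> carrier_mat n n"
  shows "foldr (*) As (1\<^sub>m n) \<in> carrier_mat n n"
  using assms by (induction As) (auto intro!: mult_carrier_mat[of _ n n])

text \<open>\<open>rev [2..<Suc l]\<close> lists l, ..., 2, so passing from l to l + 1 puts one new
  factor on the left, and for l = 1 the product is the identity. All levels l \<le> k are covered
  because the induction runs over l with the size k fixed.\<close>

lemma M_hat_prod:
  fixes \<chi> :: "int vec"
  defines "p \<equiv> CARD('p::prime_card)"
  assumes "1 \<le> l" "l \<le> k"
  shows "transpose_mat (M_hat TYPE('p) k \<chi> l) =
    foldr (*) (map (T_mat p k) (rev [2..<Suc l])) (1\<^sub>m (p * theta p k)) * transpose_mat (chi_hat TYPE('p) k \<chi>)"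
  using assms(2,3)
proof (induction l rule: dec_induct)
  case base
  then show ?case
    using M_hat_carrier[of k \<chi> 1, where 'p='p] by (simp add: chi_hat_def p_def)
next
  case (step l)
  have p2: "2 \<le> p" by (simp add: p_def prime_card_ge_2)
  let ?F = "foldr (*) (map (T_mat p k) (rev [2..<Suc l])) (1\<^sub>m (p * theta p k))"
  \<comment> \<open>Reassociating the product requires its dimensions; every factor has a level
    between 2 and k, where \<open>T_mat_carrier\<close> applies.\<close>
  have F: "?F \<in> carrier_mat (p * theta p k) (p * theta p k)"
    using step(2,4) by (intro foldr_mult_carrier) (auto intro!: T_mat_carrier[OF p2])
  have "transpose_mat (M_hat TYPE('p) k \<chi> (Suc l)) = T_mat p k (Suc l) * transpose_mat (M_hat TYPE('p) k \<chi> l)"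
    using M_hat_step[where 'p='p, of "Suc l" k \<chi>] step(1,4) by (simp add: p_def)
  also have "\<dots> = T_mat p k (Suc l) * (?F * transpose_mat (chi_hat TYPE('p) k \<chi>))"
    using step by simp
  also have "\<dots> = (T_mat p k (Suc l) * ?F) * transpose_mat (chi_hat TYPE('p) k \<chi>)"
    using T_mat_carrier[OF p2, of "Suc l" k] F M_hat_carrier[of k \<chi> 1, where 'p='p] step(1,4)
    by (intro assoc_mult_mat[symmetric]) (auto simp: chi_hat_def p_def)
  finally show ?case using step(1) by simp
qed

theorem theorem2:
  fixes p n k :: nat
    and C :: "'p::prime_card mod_ring vec set"
    and A :: "'p mod_ring mat"
    and \<chi> :: "int vec"
  assumes "p = CARD('p)"
    and "k \<ge> 2"
    and "linear_code n k C"
    and "generator_matrix n k C A"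
    and "\<chi> = characteristic_vector k A"
  shows "(\<forall>l\<in>{2..k}.
            transpose_mat (M_hat TYPE('p) k \<chi> l)
              = T_mat p k l * transpose_mat (M_hat TYPE('p) k \<chi> (l - 1)))
       \<and> transpose_mat (M_hat TYPE('p) k \<chi> k)
              = foldr (*) (map (T_mat p k) (rev [2..<Suc k])) (1\<^sub>m (p * theta p k))
                  * transpose_mat (chi_hat TYPE('p) k \<chi>)"
  using M_hat_step[where 'p='p, of _ k \<chi>] M_hat_prod[where 'p='p, of k k \<chi>] assms(1,2) by auto

end
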